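(* Let $N\ge 4$, $0<\gamma<4$, $s_0=\gamma/4$. Assume $0<s\le s_0$ and that $V\in C^1(\mathbb{R}^N)$ satisfies condition (V). Then the infimum $S_{s,\gamma}^V$ is not attained in $H^s(\mathbb{R}^N)\setminus\{0\}$.
   Context: Condition (V): $V\in C^1(\mathbb{R}^N)$, $0<V_0\le V(x)<V_\infty:=\lim_{|x|\to\infty}V(x)<+\infty$ for all $x\in\mathbb{R}^N$ (with $V_0$ a constant), and $x\cdot\nabla V$ is bounded on $\mathbb{R}^N$. The fractional Laplacian is defined on the Schwartz space by $\mathcal{F}[(-\Delta)^s u](\xi)=|\xi|^{2s}\mathcal{F}(u)(\xi)$, where $\mathcal{F}(u)(\xi)=\int_{\mathbb{R}^N}e^{-ix\cdot\xi}u(x)\,dx$ is the Fourier transform. For $u\in H^s(\mathbb{R}^N)$ set $$\|u\|_{s,V}^2=\int_{\mathbb{R}^N}|(-\Delta)^{\frac s2}u(x)|^2\,dx+\int_{\mathbb{R}^N}V(x)|u(x)|^2\,dx,\qquad D_\gamma(u,u)=\iint_{\mathbb{R}^N\times\mathbb{R}^N}\frac{|u(x)|^2|u(y)|^2}{|x-y|^\gamma}\,dx\,dy.$$ For $u\in H^s(\mathbb{R}^N)\setminus\{0\}$ set $$I_{s,\gamma}^V(u)=\frac{\|u\|_{s,V}^2}{D_\gamma(u,u)^{1/2}},\qquad\text{and}\qquad S_{s,\gamma}^V=\inf_{u\in H^s(\mathbb{R}^N)\setminus\{0\}}I_{s,\gamma}^V(u).$$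
   Formalization: The infimum and its attainment are taken over nonzero u in H^s with D_γ(u,u) finite; for s < s_0 there are u in H^s with D_γ(u,u) infinite, where the quotient is undefined (reading it as 0 makes the claim false), and for s = s_0 the restriction is void. *)

theory Defs
  imports "HOL-Analysis.Analysis"
begin

(* Functions on R^N are represented by Borel measurable, complex-valued
   representatives; elements of L2 and H^s are identified up to null sets. *)

definition L2 :: "('a::euclidean_space \<Rightarrow> complex) set" where
  "L2 = {u. u \<in> borel_measurable lborel \<and> integrable lborel (\<lambda>x. (cmod (u x))\<^sup>2)}"

definition fourier :: "('a::euclidean_space \<Rightarrow> complex) \<Rightarrow> 'a \<Rightarrow> complex" where
  "fourier u \<xi> = (\<integral>x. exp (- \<i> * complex_of_real (x \<bullet> \<xi>)) * u x \<partial>lborel)"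

(* v is the Plancherel transform of u: the limit in L2 of the Fourier integrals
   of the truncations of u to balls.  It is unique up to null sets, and coincides with
   the Fourier integral when u is also integrable. The nonnegative integral
   is used so that an infinite distance is not read as 0. *)
definition is_L2_fourier ::
    "('a::euclidean_space \<Rightarrow> complex) \<Rightarrow> ('a \<Rightarrow> complex) \<Rightarrow> bool" where
  "is_L2_fourier u v \<longleftrightarrow> u \<in> L2 \<and> v \<in> L2 \<and>
     ((\<lambda>R::real. \<integral>\<^sup>+\<xi>. ennreal ((cmod (fourier (\<lambda>x. indicator (cball 0 R) x *\<^sub>R u x) \<xi> - v \<xi>))\<^sup>2) \<partial>lborel)
        \<longlongrightarrow> 0) at_top"

(* w = (-Delta)^\<sigma> u with u, w in L2, that is, F w = |xi|^(2 \<sigma>) F u. *)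
definition is_frac_laplacian ::
    "real \<Rightarrow> ('a::euclidean_space \<Rightarrow> complex) \<Rightarrow> ('a \<Rightarrow> complex) \<Rightarrow> bool" where
  "is_frac_laplacian \<sigma> u w \<longleftrightarrow>
     (\<exists>u' w'. is_L2_fourier u u' \<and> is_L2_fourier w w' \<and>
        (AE \<xi> in lborel. w' \<xi> = complex_of_real (norm \<xi> powr (2 * \<sigma>)) * u' \<xi>))"

(* A representative; it is determined up to a null set, by injectivity of the
   Plancherel transform. *)
definition frac_laplacian ::
    "real \<Rightarrow> ('a::euclidean_space \<Rightarrow> complex) \<Rightarrow> 'a \<Rightarrow> complex" where
  "frac_laplacian \<sigma> u = (SOME w. is_frac_laplacian \<sigma> u w)"

(* H^s: the u in L2 with (-Delta)^(s/2) u in L2. Membership of both u and w in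
   L2 is part of is_frac_laplacian. *)
definition Hs :: "real \<Rightarrow> ('a::euclidean_space \<Rightarrow> complex) set" where
  "Hs s = {u. \<exists>w. is_frac_laplacian (s / 2) u w}"

definition Hs_nonzero :: "real \<Rightarrow> ('a::euclidean_space \<Rightarrow> complex) set" where
  "Hs_nonzero s = {u \<in> Hs s. \<not> (AE x in lborel. u x = 0)}"

definition norm_sV_sq ::
    "real \<Rightarrow> ('a::euclidean_space \<Rightarrow> real) \<Rightarrow> ('a \<Rightarrow> complex) \<Rightarrow> real" where
  "norm_sV_sq s V u =
     (\<integral>x. (cmod (frac_laplacian (s / 2) u x))\<^sup>2 \<partial>lborel) + (\<integral>x. V x * (cmod (u x))\<^sup>2 \<partial>lborel)"

definition D_energy :: "real \<Rightarrow> ('a::euclidean_space \<Rightarrow> complex) \<Rightarrow> ennreal" where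
  "D_energy \<gamma> u =
     (\<integral>\<^sup>+(x, y). ennreal ((cmod (u x))\<^sup>2 * (cmod (u y))\<^sup>2 / norm (x - y) powr \<gamma>)
        \<partial>(lborel \<Otimes>\<^sub>M lborel))"

(* The nonzero elements of H^s at which the real quotient I_functional makes sense.
   D_energy \<gamma> u is positive for nonzero u. It is finite on all of H^s if
   s \<ge> \<gamma>/4 (Hardy-Littlewood-Sobolev and Sobolev), but can be infinite
   if s < \<gamma>/4. *)
definition I_domain :: "real \<Rightarrow> real \<Rightarrow> ('a::euclidean_space \<Rightarrow> complex) set" where
  "I_domain s \<gamma> = {u \<in> Hs_nonzero s. D_energy \<gamma> u < \<infinity>}"

definition I_functional ::
    "real \<Rightarrow> real \<Rightarrow> ('a::euclidean_space \<Rightarrow> real) \<Rightarrow> ('a \<Rightarrow> complex) \<Rightarrow> real" where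
  "I_functional s \<gamma> V u = norm_sV_sq s V u / (enn2real (D_energy \<gamma> u)) powr (1 / 2)"

definition S_inf :: "real \<Rightarrow> real \<Rightarrow> ('a::euclidean_space \<Rightarrow> real) \<Rightarrow> real" where
  "S_inf s \<gamma> V = (INF u\<in>I_domain s \<gamma>. I_functional s \<gamma> V u)"

(* V is C^1 with gradient g, and satisfies condition (V). *)
definition condition_V :: "('a::euclidean_space \<Rightarrow> real) \<Rightarrow> bool" where
  "condition_V V \<longleftrightarrow>
     (\<exists>g. (\<forall>x. GDERIV V x :> g x) \<and> continuous_on UNIV g \<and> bounded (range (\<lambda>x. x \<bullet> g x))) \<and>
     (\<exists>V0 Vinf. 0 < V0 \<and> (V \<longlongrightarrow> Vinf) at_infinity \<and> (\<forall>x. V0 \<le> V x \<and> V x < Vinf))"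

end

theory Submission
  imports Defs "HOL-Probability.Characteristic_Functions"
begin

text \<open>No element \<open>u\<close> of the domain can be a minimiser, because a concentrated copy of it has a
  strictly smaller quotient.  For \<open>c \<ge> 1\<close> put \<open>v x = a * u (c x)\<close> with \<open>a\<^sup>4 * c powr \<gamma> = c\<^sup>2\<^sup>N\<close>,
  so that \<open>D_energy \<gamma> v = D_energy \<gamma> u\<close>.  Writing \<open>A\<close> for the kinetic term of \<open>u\<close> and \<open>M\<close> for
  the square of its \<open>L\<^sup>2\<close> norm, the kinetic term of \<open>v\<close> is \<open>c powr (2 * s - \<gamma> / 2) * A \<le> A\<close>,
  as \<open>s \<le> \<gamma> / 4\<close>, and its potential term is at most \<open>c powr (- \<gamma> / 2) * Vinf * M\<close>.  The
  latter tends to zero as \<open>c\<close> grows, whereas the potential term of \<open>u\<close> is at least \<open>V0 * M > 0\<close>.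
  This is \<open>I_functional_not_minimal\<close>.

  The scaling of the kinetic term hides the only analytic difficulty.  The fractional Laplacian of \<open>v\<close>
  is an arbitrarily chosen function with the right Fourier transform, so its norm can be computed from
  the dilated fractional Laplacian of \<open>u\<close> only if the Fourier transform on \<open>L\<^sup>2\<close> is injective.  Since the
  transform is given as a limit of truncated Fourier integrals, injectivity
  (\<open>is_L2_fourier_inj\<close>) amounts to this: if the truncated integrals of \<open>f\<close> tend to zero in \<open>L\<^sup>2\<close>, then
  \<open>f\<close> vanishes almost everywhere.  Pairing with Fourier preimages of Gaussians shows that every Gaussian
  average of \<open>f\<close> is zero (\<open>L2_fourier_zero_imp_gaussian_integral_zero\<close>).  Around a fixed centre the
  powers of a Gaussian are again Gaussians, so Weierstrass approximation gives vanishing integrals over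
  balls for \<open>f\<close> times a Gaussian weight (\<open>ball_integral_zero_if_gaussian_integrals_zero\<close>), and the
  Vitali covering theorem passes from balls to open sets, which determine the function
  (\<open>AE_zero_if_ball_integrals_zero\<close>).\<close>

section \<open>Square-integrable functions and their truncated Fourier integrals\<close>

lemma L2_D:
  assumes "u \<in> L2"
  shows "u \<in> borel_measurable borel" "integrable lborel (\<lambda>x. (cmod (u x))\<^sup>2)"
  using assms by (auto simp: L2_def)

lemma L2_integral_pos_iff:
  assumes "u \<in> L2"
  shows "0 < (\<integral>x. (cmod (u x))\<^sup>2 \<partial>lborel) \<longleftrightarrow> \<not> (AE x in lborel. u x = 0)"
proof -
  have "(\<integral>x. (cmod (u x))\<^sup>2 \<partial>lborel) = 0 \<longleftrightarrow> (AE x in lborel. u x = 0)"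
    using integral_nonneg_eq_0_iff_AE[OF L2_D(2)[OF assms]] by simp
  moreover have "0 \<le> (\<integral>x. (cmod (u x))\<^sup>2 \<partial>lborel)"
    by simp
  ultimately show ?thesis
    by linarith
qed

lemma norm_diff_sq_le:
  fixes x y :: "'a::real_normed_vector"
  shows "(norm (x - y))\<^sup>2 \<le> 2 * (norm x)\<^sup>2 + 2 * (norm y)\<^sup>2"
proof -
  have "(norm (x - y))\<^sup>2 \<le> (norm x + norm y)\<^sup>2"
    by (intro power_mono norm_triangle_ineq4) simp
  also have "\<dots> \<le> 2 * (norm x)\<^sup>2 + 2 * (norm y)\<^sup>2"
    using sum_squares_bound[of "norm x" "norm y"] by (simp add: power2_sum)
  finally show ?thesis .
qed

lemma L2_diff:
  assumes "u \<in> L2" "v \<in> L2"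
  shows "(\<lambda>x. u x - v x) \<in> L2"
proof -
  note [measurable] = L2_D(1)[OF assms(1)] L2_D(1)[OF assms(2)]
  have "integrable lborel (\<lambda>x. (cmod (u x - v x))\<^sup>2)"
  proof (rule Bochner_Integration.integrable_bound)
    show "integrable lborel (\<lambda>x. 2 * (cmod (u x))\<^sup>2 + 2 * (cmod (v x))\<^sup>2)"
      using L2_D(2)[OF assms(1)] L2_D(2)[OF assms(2)] by auto
    show "AE x in lborel. norm ((cmod (u x - v x))\<^sup>2) \<le> norm (2 * (cmod (u x))\<^sup>2 + 2 * (cmod (v x))\<^sup>2)"
      by (simp add: norm_diff_sq_le)
  qed measurable
  then show ?thesis
    by (auto simp: L2_def)
qed

lemma nn_integral_norm_diff_sq_le:
  fixes f g :: "'b \<Rightarrow> complex"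
  assumes [measurable]: "f \<in> borel_measurable M" "g \<in> borel_measurable M"
  shows "(\<integral>\<^sup>+x. ennreal ((cmod (f x - g x))\<^sup>2) \<partial>M) \<le>
    2 * (\<integral>\<^sup>+x. ennreal ((cmod (f x))\<^sup>2) \<partial>M) + 2 * (\<integral>\<^sup>+x. ennreal ((cmod (g x))\<^sup>2) \<partial>M)"
proof -
  have "(\<integral>\<^sup>+x. ennreal ((cmod (f x - g x))\<^sup>2) \<partial>M) \<le>
      (\<integral>\<^sup>+x. ennreal (2 * (cmod (f x))\<^sup>2 + 2 * (cmod (g x))\<^sup>2) \<partial>M)"
    by (intro nn_integral_mono ennreal_leI norm_diff_sq_le)
  also have "\<dots> = (\<integral>\<^sup>+x. 2 * ennreal ((cmod (f x))\<^sup>2) + 2 * ennreal ((cmod (g x))\<^sup>2) \<partial>M)"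
    by (simp add: ennreal_plus ennreal_mult)
  also have "\<dots> = 2 * (\<integral>\<^sup>+x. ennreal ((cmod (f x))\<^sup>2) \<partial>M) + 2 * (\<integral>\<^sup>+x. ennreal ((cmod (g x))\<^sup>2) \<partial>M)"
    by (simp add: nn_integral_add nn_integral_cmult)
  finally show ?thesis .
qed

lemma norm_integral_mult_sq_le:
  fixes f g :: "'b \<Rightarrow> complex"
  assumes [measurable]: "f \<in> borel_measurable M" "g \<in> borel_measurable M"
  shows "ennreal ((cmod (\<integral>x. f x * g x \<partial>M))\<^sup>2) \<le>
    (\<integral>\<^sup>+x. ennreal ((cmod (f x))\<^sup>2) \<partial>M) * (\<integral>\<^sup>+x. ennreal ((cmod (g x))\<^sup>2) \<partial>M)"
proof -
  have "ennreal (cmod (\<integral>x. f x * g x \<partial>M)) \<le> (\<integral>\<^sup>+x. ennreal (cmod (f x)) * ennreal (cmod (g x)) \<partial>M)"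
  proof (cases "integrable M (\<lambda>x. f x * g x)")
    case True
    from integral_norm_bound_ennreal[OF this] show ?thesis
      by (simp add: norm_mult ennreal_mult)
  qed (simp add: not_integrable_integral_eq)
  then have "ennreal (cmod (\<integral>x. f x * g x \<partial>M)) ^ 2 \<le> (\<integral>\<^sup>+x. ennreal (cmod (f x)) * ennreal (cmod (g x)) \<partial>M) ^ 2"
    by (intro power_mono) auto
  also have "\<dots> \<le> (\<integral>\<^sup>+x. ennreal (cmod (f x)) ^ 2 \<partial>M) * (\<integral>\<^sup>+x. ennreal (cmod (g x)) ^ 2 \<partial>M)"
    by (intro Cauchy_Schwarz_nn_integral) measurable
  finally show ?thesis
    by (simp add: ennreal_power)
qed

lemma integrable_mult_L2:
  fixes f g :: "'b \<Rightarrow> complex"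
  assumes [measurable]: "f \<in> borel_measurable M" "g \<in> borel_measurable M"
    and "integrable M (\<lambda>x. (cmod (f x))\<^sup>2)" "integrable M (\<lambda>x. (cmod (g x))\<^sup>2)"
  shows "integrable M (\<lambda>x. f x * g x)"
proof (rule Bochner_Integration.integrable_bound)
  show "integrable M (\<lambda>x. (cmod (f x))\<^sup>2 + (cmod (g x))\<^sup>2)"
    using assms by auto
  have "cmod (f x) * cmod (g x) \<le> (cmod (f x))\<^sup>2 + (cmod (g x))\<^sup>2" for x
    using sum_squares_bound[of "cmod (f x)" "cmod (g x)"]
      mult_nonneg_nonneg[OF norm_ge_zero[of "f x"] norm_ge_zero[of "g x"]] by linarith
  then show "AE x in M. norm (f x * g x) \<le> norm ((cmod (f x))\<^sup>2 + (cmod (g x))\<^sup>2)"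
    by (simp add: norm_mult)
qed measurable

lemma integrable_truncated:
  fixes f :: "'a::euclidean_space \<Rightarrow> complex"
  assumes "f \<in> L2"
  shows "integrable lborel (\<lambda>x. indicator (cball 0 R) x *\<^sub>R f x)"
proof -
  have "integrable lborel (indicator (cball (0::'a) R) :: 'a \<Rightarrow> real)"
    using emeasure_lborel_cball_finite[of "0::'a" R] by (simp add: less_top)
  moreover have "(cmod (indicator (cball 0 R) x))\<^sup>2 = indicator (cball 0 R) x" for x :: 'a
    by (simp add: indicator_def)
  moreover have [measurable]: "cball (0::'a) R \<in> sets borel"
    by simp
  ultimately have "integrable lborel (\<lambda>x. indicator (cball 0 R) x * f x)"
    using L2_D[OF assms] by (intro integrable_mult_L2) auto
  moreover have "indicator (cball 0 R) x *\<^sub>R f x = indicator (cball 0 R) x * f x" for x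
    by (simp add: indicator_def)
  ultimately show ?thesis
    by simp
qed

lemma fourier_measurable:
  fixes u :: "'a::euclidean_space \<Rightarrow> complex"
  assumes [measurable]: "u \<in> borel_measurable borel"
  shows "fourier u \<in> borel_measurable borel"
proof -
  have "(\<lambda>\<xi>. fourier u \<xi>) \<in> borel_measurable borel"
    unfolding fourier_def by measurable
  then show ?thesis by simp
qed

lemma fourier_truncated_measurable:
  fixes u :: "'a::euclidean_space \<Rightarrow> complex"
  assumes "u \<in> L2"
  shows "fourier (\<lambda>x. indicator (cball 0 R) x *\<^sub>R u x) \<in> borel_measurable borel"
  using borel_measurable_integrable[OF integrable_truncated[OF assms, of R]]
  by (intro fourier_measurable) simp

section \<open>Dilations\<close>

lemma nn_integral_scaleR:
  fixes f :: "'a::euclidean_space \<Rightarrow> ennreal"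
  assumes [measurable]: "f \<in> borel_measurable borel" and "c > 0"
  shows "(\<integral>\<^sup>+x. f x \<partial>lborel) = ennreal (c ^ DIM('a)) * (\<integral>\<^sup>+x. f (c *\<^sub>R x) \<partial>lborel)"
  using assms(2)
  by (subst lborel_affine[of c 0]) (simp_all add: nn_integral_density nn_integral_distr nn_integral_cmult)

lemma integral_scaleR:
  fixes f :: "'a::euclidean_space \<Rightarrow> 'b::{banach, second_countable_topology}"
  assumes [measurable]: "f \<in> borel_measurable borel" and "c > 0"
  shows "(\<integral>x. f x \<partial>lborel) = c ^ DIM('a) *\<^sub>R (\<integral>x. f (c *\<^sub>R x) \<partial>lborel)"
  using assms(2)
  by (subst lborel_affine[of c 0]) (simp_all add: integral_density integral_distr)

lemma integrable_scaleR:
  fixes f :: "'a::euclidean_space \<Rightarrow> 'b::{banach, second_countable_topology}"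
  assumes f: "integrable lborel f" and "c > 0"
  shows "integrable lborel (\<lambda>x. f (c *\<^sub>R x))"
proof -
  have [measurable]: "f \<in> borel_measurable borel"
    using f by auto
  have "integrable (density (distr lborel borel (\<lambda>x. 0 + c *\<^sub>R x)) (\<lambda>_. \<bar>c\<bar> ^ DIM('a))) f"
    using f lborel_affine[of c "0::'a"] \<open>c > 0\<close> by (metis less_irrefl)
  then have "integrable lborel (\<lambda>x. c ^ DIM('a) *\<^sub>R f (c *\<^sub>R x))"
    using \<open>c > 0\<close> by (simp add: integrable_density integrable_distr_eq)
  then have "integrable lborel (\<lambda>x. inverse (c ^ DIM('a)) *\<^sub>R c ^ DIM('a) *\<^sub>R f (c *\<^sub>R x))"
    by (rule integrable_scaleR_right)
  moreover have "inverse (c ^ DIM('a)) *\<^sub>R c ^ DIM('a) *\<^sub>R y = y" for y :: 'b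
    using \<open>c > 0\<close> by simp
  ultimately show ?thesis
    by simp
qed

lemma AE_lborel_scaleR:
  fixes P :: "'a::euclidean_space \<Rightarrow> bool"
  assumes [measurable]: "Measurable.pred borel P" and "AE x in lborel. P x" and "c > 0"
  shows "AE x in lborel. P (c *\<^sub>R x)"
proof -
  have "AE x in density (distr lborel borel (\<lambda>x. 0 + c *\<^sub>R x)) (\<lambda>_. ennreal (\<bar>c\<bar> ^ DIM('a))). P x"
    using assms lborel_affine[of c "0::'a"] by (metis less_irrefl)
  then show ?thesis
    using \<open>c > 0\<close> by (simp add: AE_density AE_distr_iff)
qed

text \<open>The amplitude \<open>a\<close> is kept separate from the scale \<open>c\<close> because the two are matched only
  at the end, so that the nonlocal energy is unchanged.  The Fourier transform of a dilation is a
  dilation with other parameters.\<close>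
definition dilate :: "real \<Rightarrow> real \<Rightarrow> ('a::euclidean_space \<Rightarrow> complex) \<Rightarrow> 'a \<Rightarrow> complex" where
  "dilate a c u = (\<lambda>x. a *\<^sub>R u (c *\<^sub>R x))"

lemma L2_dilate:
  assumes "u \<in> L2" "c > 0"
  shows "dilate a c u \<in> L2"
proof -
  note [measurable] = L2_D(1)[OF assms(1)]
  have "integrable lborel (\<lambda>x. a\<^sup>2 * (cmod (u (c *\<^sub>R x)))\<^sup>2)"
    using integrable_scaleR[OF L2_D(2)[OF assms(1)] assms(2)] by simp
  then show ?thesis
    by (auto simp: L2_def dilate_def power_mult_distrib)
qed

lemma integral_norm_dilate:
  fixes u :: "'a::euclidean_space \<Rightarrow> complex"
  assumes "u \<in> L2" "c > 0"
  shows "c ^ DIM('a) * (\<integral>x. (cmod (dilate a c u x))\<^sup>2 \<partial>lborel) = a\<^sup>2 * (\<integral>x. (cmod (u x))\<^sup>2 \<partial>lborel)"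
proof -
  note [measurable] = L2_D(1)[OF assms(1)]
  show ?thesis
    by (subst (2) integral_scaleR[OF _ assms(2)]) (auto simp: dilate_def power_mult_distrib)
qed

lemma fourier_truncated_dilate:
  fixes u :: "'a::euclidean_space \<Rightarrow> complex"
  assumes [measurable]: "u \<in> borel_measurable borel" and "c > 0"
  shows "fourier (\<lambda>x. indicator (cball 0 R) x *\<^sub>R dilate a c u x) \<xi> =
     (a / c ^ DIM('a)) *\<^sub>R fourier (\<lambda>x. indicator (cball 0 (c * R)) x *\<^sub>R u x) ((1 / c) *\<^sub>R \<xi>)"
proof -
  have [measurable]: "cball (0::'a) r \<in> sets borel" for r
    by simp
  have "fourier (\<lambda>x. indicator (cball 0 (c * R)) x *\<^sub>R u x) ((1 / c) *\<^sub>R \<xi>) =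
    c ^ DIM('a) *\<^sub>R (\<integral>x. exp (- \<i> * complex_of_real ((c *\<^sub>R x) \<bullet> ((1 / c) *\<^sub>R \<xi>))) *
      (indicator (cball 0 (c * R)) (c *\<^sub>R x) *\<^sub>R u (c *\<^sub>R x)) \<partial>lborel)"
    unfolding fourier_def by (rule integral_scaleR[OF _ assms(2)]) measurable
  moreover have "indicator (cball 0 (c * R)) (c *\<^sub>R x) = (indicator (cball 0 R) x :: real)" for x :: 'a
    using assms(2) by (auto simp: indicator_def)
  ultimately show ?thesis
    using assms(2) unfolding fourier_def dilate_def
    by (simp flip: Bochner_Integration.integral_scaleR_right add: mult_ac scaleR_conv_of_real)
qed

lemma is_L2_fourier_dilate:
  fixes u :: "'a::euclidean_space \<Rightarrow> complex"
  assumes "is_L2_fourier u v" "c > 0"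
  shows "is_L2_fourier (dilate a c u) (dilate (a / c ^ DIM('a)) (1 / c) v)"
proof -
  from assms have uv: "u \<in> L2" "v \<in> L2" and
    lim: "((\<lambda>R::real. \<integral>\<^sup>+\<xi>. ennreal ((cmod (fourier (\<lambda>x. indicator (cball 0 R) x *\<^sub>R u x) \<xi> - v \<xi>))\<^sup>2) \<partial>lborel)
        \<longlongrightarrow> 0) at_top"
    by (auto simp: is_L2_fourier_def)
  note [measurable] = L2_D(1)[OF uv(1)] L2_D(1)[OF uv(2)]
  let ?F = "\<lambda>R. fourier (\<lambda>x. indicator (cball 0 R) x *\<^sub>R u x)"
  let ?b = "a / c ^ DIM('a)"
  have [measurable]: "?F R \<in> borel_measurable borel" for R
    by (intro fourier_measurable borel_measurable_scaleR borel_measurable_indicator) auto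
  have eq: "(\<integral>\<^sup>+\<xi>. ennreal ((cmod (fourier (\<lambda>x. indicator (cball 0 R) x *\<^sub>R dilate a c u x) \<xi>
        - dilate ?b (1 / c) v \<xi>))\<^sup>2) \<partial>lborel)
     = ennreal (?b\<^sup>2 * c ^ DIM('a)) *
        (\<integral>\<^sup>+\<xi>. ennreal ((cmod (?F (c * R) \<xi> - v \<xi>))\<^sup>2) \<partial>lborel)" for R
  proof -
    have "(\<integral>\<^sup>+\<xi>. ennreal ((cmod (fourier (\<lambda>x. indicator (cball 0 R) x *\<^sub>R dilate a c u x) \<xi>
        - dilate ?b (1 / c) v \<xi>))\<^sup>2) \<partial>lborel)
      = (\<integral>\<^sup>+\<xi>. ennreal (?b\<^sup>2) * ennreal ((cmod (?F (c * R) ((1 / c) *\<^sub>R \<xi>) - v ((1 / c) *\<^sub>R \<xi>)))\<^sup>2) \<partial>lborel)"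
      unfolding fourier_truncated_dilate[OF \<open>u \<in> borel_measurable borel\<close> assms(2)]
      unfolding dilate_def
      by (simp add: norm_mult power_mult_distrib power_divide flip: ennreal_mult scaleR_diff_right)
    also have "\<dots> = ennreal (?b\<^sup>2) * (\<integral>\<^sup>+\<xi>. ennreal ((cmod (?F (c * R) ((1 / c) *\<^sub>R \<xi>) - v ((1 / c) *\<^sub>R \<xi>)))\<^sup>2) \<partial>lborel)"
      by (intro nn_integral_cmult) measurable
    also have "(\<integral>\<^sup>+\<xi>. ennreal ((cmod (?F (c * R) ((1 / c) *\<^sub>R \<xi>) - v ((1 / c) *\<^sub>R \<xi>)))\<^sup>2) \<partial>lborel)
      = ennreal (c ^ DIM('a)) * (\<integral>\<^sup>+\<xi>. ennreal ((cmod (?F (c * R) \<xi> - v \<xi>))\<^sup>2) \<partial>lborel)"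
      using assms(2) by (subst nn_integral_scaleR[where c = c]) (auto simp: ac_simps)
    finally show ?thesis
      using assms(2) by (simp add: ennreal_mult mult.assoc)
  qed
  have "filterlim (\<lambda>R. c * R) at_top at_top"
    using assms(2) by (simp add: filterlim_tendsto_pos_mult_at_top[OF tendsto_const] filterlim_ident)
  from filterlim_compose[OF lim this]
  have "((\<lambda>R. ennreal (?b\<^sup>2 * c ^ DIM('a)) * (\<integral>\<^sup>+\<xi>. ennreal ((cmod (?F (c * R) \<xi> - v \<xi>))\<^sup>2) \<partial>lborel))
    \<longlongrightarrow> ennreal (?b\<^sup>2 * c ^ DIM('a)) * 0) at_top"
    by (intro ennreal_tendsto_cmult) auto
  then show ?thesis
    using uv assms(2) by (simp add: is_L2_fourier_def L2_dilate eq)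
qed

lemma is_frac_laplacian_dilate:
  fixes u :: "'a::euclidean_space \<Rightarrow> complex"
  assumes "is_frac_laplacian \<sigma> u w" "c > 0"
  shows "is_frac_laplacian \<sigma> (dilate a c u) (dilate (a * c powr (2 * \<sigma>)) c w)"
proof -
  from assms(1) obtain u' w' where u': "is_L2_fourier u u'" and w': "is_L2_fourier w w'" and
    ae: "AE \<xi> in lborel. w' \<xi> = complex_of_real (norm \<xi> powr (2 * \<sigma>)) * u' \<xi>"
    by (auto simp: is_frac_laplacian_def)
  have [measurable]: "u' \<in> borel_measurable borel" "w' \<in> borel_measurable borel"
    using u' w' by (auto simp: is_L2_fourier_def L2_D)
  have "AE \<xi> in lborel. w' ((1 / c) *\<^sub>R \<xi>) = complex_of_real (norm ((1 / c) *\<^sub>R \<xi>) powr (2 * \<sigma>)) * u' ((1 / c) *\<^sub>R \<xi>)"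
    by (rule AE_lborel_scaleR[OF _ ae]) (use \<open>c > 0\<close> in auto)
  then have "AE \<xi> in lborel. dilate (a * c powr (2 * \<sigma>) / c ^ DIM('a)) (1 / c) w' \<xi> =
      complex_of_real (norm \<xi> powr (2 * \<sigma>)) * dilate (a / c ^ DIM('a)) (1 / c) u' \<xi>"
    by eventually_elim
       (use \<open>c > 0\<close> in \<open>simp add: dilate_def powr_divide scaleR_conv_of_real field_simps\<close>)
  then show ?thesis
    using is_L2_fourier_dilate[OF u' \<open>c > 0\<close>] is_L2_fourier_dilate[OF w' \<open>c > 0\<close>]
    unfolding is_frac_laplacian_def by blast
qed

text \<open>The substitution \<open>x = c x'\<close>, \<open>y = c y'\<close> produces the Jacobian \<open>c\<^sup>2\<^sup>N\<close> and the kernel has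
  homogeneity \<open>-\<gamma>\<close>; the hypothesis on \<open>a\<close> says that the amplitude compensates both.\<close>
lemma D_energy_dilate:
  fixes u :: "'a::euclidean_space \<Rightarrow> complex"
  assumes [measurable]: "u \<in> borel_measurable borel" and "c > 0"
    and a: "a ^ 4 * c powr \<gamma> = (c ^ DIM('a))\<^sup>2"
  shows "D_energy \<gamma> (dilate a c u) = D_energy \<gamma> u"
proof -
  define k where "k v x y = ennreal ((cmod (v x))\<^sup>2 * (cmod (v y))\<^sup>2 / norm (x - y) powr \<gamma>)"
    for v :: "'a \<Rightarrow> complex" and x y
  let ?d = "ennreal (c ^ DIM('a))"
  have [measurable]: "dilate a c u \<in> borel_measurable borel"
    unfolding dilate_def by measurable
  have D: "D_energy \<gamma> v = (\<integral>\<^sup>+x. \<integral>\<^sup>+y. k v x y \<partial>lborel \<partial>lborel)"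
    if [measurable]: "v \<in> borel_measurable borel" for v
    unfolding D_energy_def k_def by (subst lborel.nn_integral_fst[symmetric]) auto
  have k: "k (dilate a c u) x y = ?d * (?d * k u (c *\<^sub>R x) (c *\<^sub>R y))" for x y
  proof -
    have "norm (c *\<^sub>R x - c *\<^sub>R y) powr \<gamma> = c powr \<gamma> * norm (x - y) powr \<gamma>"
      using \<open>c > 0\<close> by (simp add: powr_mult flip: scaleR_diff_right)
    moreover have "a ^ 4 = c ^ DIM('a) * c ^ DIM('a) / c powr \<gamma>"
      using a \<open>c > 0\<close> by (simp add: field_simps power2_eq_square)
    moreover have "a\<^sup>2 * a\<^sup>2 = a ^ 4"
      by simp
    ultimately have "(cmod (dilate a c u x))\<^sup>2 * (cmod (dilate a c u y))\<^sup>2 / norm (x - y) powr \<gamma> =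
      c ^ DIM('a) * (c ^ DIM('a) * ((cmod (u (c *\<^sub>R x)))\<^sup>2 * (cmod (u (c *\<^sub>R y)))\<^sup>2 / norm (c *\<^sub>R x - c *\<^sub>R y) powr \<gamma>))"
      by (simp add: dilate_def power_mult_distrib field_simps)
    then show ?thesis
      using \<open>c > 0\<close> unfolding k_def by (simp flip: ennreal_mult)
  qed
  have [measurable]: "(\<lambda>(x, y). k u x y) \<in> borel_measurable (borel \<Otimes>\<^sub>M borel)"
    unfolding k_def by measurable
  have "D_energy \<gamma> (dilate a c u) = (\<integral>\<^sup>+x. ?d * (\<integral>\<^sup>+y. ?d * k u (c *\<^sub>R x) (c *\<^sub>R y) \<partial>lborel) \<partial>lborel)"
    by (simp add: D k nn_integral_cmult)
  also have "\<dots> = (\<integral>\<^sup>+x. ?d * (\<integral>\<^sup>+y. k u (c *\<^sub>R x) y \<partial>lborel) \<partial>lborel)"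
    using \<open>c > 0\<close> by (simp add: nn_integral_cmult nn_integral_scaleR[of "k u _"])
  also have "\<dots> = ?d * (\<integral>\<^sup>+x. (\<integral>\<^sup>+y. k u (c *\<^sub>R x) y \<partial>lborel) \<partial>lborel)"
    by (intro nn_integral_cmult) measurable
  also have "\<dots> = D_energy \<gamma> u"
    using \<open>c > 0\<close> by (simp add: D nn_integral_scaleR[of "\<lambda>x. \<integral>\<^sup>+y. k u x y \<partial>lborel", OF _ \<open>c > 0\<close>])
  finally show ?thesis .
qed

text \<open>Vanishing energy would give the quotient the default value \<open>0\<close> of division by zero, so this case
  has to be excluded.  The kernel is positive off the diagonal, where for fixed \<open>x\<close> only the
  null set \<open>{x}\<close> is lost.\<close>
lemma D_energy_eq_0D:
  fixes u :: "'a::euclidean_space \<Rightarrow> complex"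
  assumes [measurable]: "u \<in> borel_measurable borel" and "D_energy \<gamma> u = 0"
  shows "AE x in lborel. u x = 0"
proof -
  have "AE z in lborel \<Otimes>\<^sub>M lborel. (case z of (x, y) \<Rightarrow>
      ennreal ((cmod (u x))\<^sup>2 * (cmod (u y))\<^sup>2 / norm (x - y) powr \<gamma>)) = 0"
    using assms(2) unfolding D_energy_def by (subst (asm) nn_integral_0_iff_AE) auto
  then have "AE x in lborel. AE y in lborel.
      ennreal ((cmod (u x))\<^sup>2 * (cmod (u y))\<^sup>2 / norm (x - y) powr \<gamma>) = 0"
    by (auto dest!: lborel_pair.AE_pair)
  then have "AE x in lborel. u x = 0 \<or> (AE y in lborel. u y = 0)"
  proof eventually_elim
    case (elim x)
    show ?case
    proof (cases "u x = 0")
      case False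
      have "AE y in lborel. u y = 0"
        using elim AE_lborel_singleton[of x] by eventually_elim (use False in \<open>auto simp: ennreal_eq_0_iff divide_le_0_iff mult_le_0_iff\<close>)
      then show ?thesis ..
    qed simp
  qed
  then show ?thesis
    by (cases "AE y in lborel. u y = 0") auto
qed

section \<open>Fourier transforms of Gaussians\<close>

text \<open>Up to the factor \<open>sqrt (2 * pi)\<close> this is the characteristic function of the standard normal
  distribution.\<close>
lemma gaussian_fourier_real:
  fixes t :: real
  shows "integrable lborel (\<lambda>x. exp (- \<i> * complex_of_real (x * t)) * complex_of_real (exp (- x\<^sup>2 / 2)))"
    and "(\<integral>x. exp (- \<i> * complex_of_real (x * t)) * complex_of_real (exp (- x\<^sup>2 / 2)) \<partial>lborel)
      = complex_of_real (sqrt (2 * pi) * exp (- t\<^sup>2 / 2))"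
proof -
  let ?d = "std_normal_density" and ?g = "\<lambda>x. exp (- \<i> * complex_of_real (x * t)) * complex_of_real (exp (- x\<^sup>2 / 2))"
  have eq: "?g x = sqrt (2 * pi) *\<^sub>R (?d x *\<^sub>R iexp (- t * x))" for x
    by (simp add: std_normal_density_def scaleR_conv_of_real mult_ac)
  have "integrable lborel (\<lambda>x. ?d x *\<^sub>R iexp (- t * x))"
    by (rule Bochner_Integration.integrable_bound[OF integrable_normal_density[of 1 0]])
       (auto simp: norm_mult)
  then show "integrable lborel ?g"
    unfolding eq by (rule integrable_scaleR_right)
  have "char std_normal_distribution (- t) = (\<integral>x. ?d x *\<^sub>R iexp (- t * x) \<partial>lborel)"
    unfolding char_def by (subst integral_density) (auto simp: normal_density_nonneg)
  then have "(\<integral>x. ?d x *\<^sub>R iexp (- t * x) \<partial>lborel) = complex_of_real (exp (- t\<^sup>2 / 2))"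
    by (simp add: char_std_normal_distribution)
  then show "(\<integral>x. ?g x \<partial>lborel) = complex_of_real (sqrt (2 * pi) * exp (- t\<^sup>2 / 2))"
    unfolding eq by (simp add: scaleR_conv_of_real)
qed

text \<open>Lebesgue measure is the product of its one-dimensional copies along \<open>Basis\<close>, and both the Gaussian
  and the character factor along the coordinates.\<close>
lemma gaussian_fourier:
  fixes \<xi> :: "'a::euclidean_space"
  shows "integrable lborel (\<lambda>x. exp (- \<i> * complex_of_real (x \<bullet> \<xi>)) * complex_of_real (exp (- (norm x)\<^sup>2 / 2)))" (is ?A)
    and "fourier (\<lambda>x. complex_of_real (exp (- (norm x)\<^sup>2 / 2))) \<xi> =
      complex_of_real (sqrt (2 * pi) ^ DIM('a) * exp (- (norm \<xi>)\<^sup>2 / 2))" (is ?B)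
proof -
  interpret product_sigma_finite "\<lambda>_::'a. lborel :: real measure" by standard
  define g where "g b x = exp (- \<i> * complex_of_real (x * (\<xi> \<bullet> b))) * complex_of_real (exp (- x\<^sup>2 / 2))"
    for b :: 'a and x :: real
  define G where "G x = exp (- \<i> * complex_of_real (x \<bullet> \<xi>)) * complex_of_real (exp (- (norm x)\<^sup>2 / 2))"
    for x :: 'a
  let ?P = "\<Pi>\<^sub>M b\<in>Basis. lborel :: real measure" and ?T = "\<lambda>f. \<Sum>b\<in>(Basis :: 'a set). f b *\<^sub>R b"
  have normsq: "(norm x)\<^sup>2 = (\<Sum>b\<in>Basis. (x \<bullet> b)\<^sup>2)" for x :: 'a
    unfolding power2_norm_eq_inner by (subst euclidean_inner) (simp add: power2_eq_square)
  have G: "G x = (\<Prod>b\<in>Basis. g b (x \<bullet> b))" for x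
    unfolding G_def g_def normsq euclidean_inner[of x \<xi>]
    by (simp add: prod.distrib exp_sum sum_distrib_left sum_divide_distrib
          flip: sum_negf exp_of_real)
  have GT: "G (?T f) = (\<Prod>b\<in>Basis. g b (f b))" for f
    unfolding G by (intro prod.cong) (simp_all add: inner_sum_left_Basis)
  have [measurable]: "G \<in> borel_measurable borel"
    unfolding G_def by measurable
  have "integrable ?P (\<lambda>f. G (?T f))"
    unfolding GT g_def by (intro product_integrable_prod gaussian_fourier_real) auto
  then show ?A
    unfolding G_def[symmetric] by (subst lborel_eq, subst integrable_distr_eq) auto
  have "(\<integral>x. G x \<partial>lborel) = (\<integral>f. G (?T f) \<partial>?P)"
    by (subst lborel_eq, subst integral_distr) auto
  also have "\<dots> = (\<Prod>b\<in>Basis. \<integral>x. g b x \<partial>lborel)"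
    unfolding GT g_def by (intro product_integral_prod gaussian_fourier_real) auto
  also have "\<dots> = (\<Prod>b\<in>(Basis :: 'a set). complex_of_real (sqrt (2 * pi) * exp (- (\<xi> \<bullet> b)\<^sup>2 / 2)))"
    unfolding g_def by (intro prod.cong gaussian_fourier_real) auto
  also have "\<dots> = complex_of_real (sqrt (2 * pi) ^ DIM('a) * exp (- (norm \<xi>)\<^sup>2 / 2))"
    unfolding normsq
    by (simp add: prod.distrib exp_sum sum_divide_distrib flip: sum_negf)
  finally show ?B
    unfolding fourier_def G_def .
qed

lemma integrable_gaussian:
  fixes y :: "'a::euclidean_space"
  assumes "a > 0"
  shows "integrable lborel (\<lambda>x. exp (- a * (norm (x - y))\<^sup>2))"
proof -
  have "integrable lborel (\<lambda>x::'a. Re (complex_of_real (exp (- (norm x)\<^sup>2 / 2))))"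
    using gaussian_fourier(1)[of "0::'a"] by (intro integrable_Re) simp
  then have "integrable lborel (\<lambda>x::'a. exp (- (norm x)\<^sup>2 / 2))"
    by simp
  from integrable_scaleR[OF this, of "sqrt (2 * a)"] have "integrable lborel (\<lambda>x::'a. exp (- a * (norm x)\<^sup>2))"
    using assms by (simp add: power_mult_distrib)
  then have "integrable (distr lborel borel ((+) (- y))) (\<lambda>x::'a. exp (- a * (norm x)\<^sup>2))"
    by (simp add: lborel_distr_plus)
  then show ?thesis
    by (simp add: integrable_distr_eq)
qed

text \<open>Every Gaussian, of any centre \<open>y\<close> and width, is a Fourier transform: modulating by the
  character of \<open>y\<close> moves the centre to \<open>y\<close>, and dilating sets the width.\<close>
lemma fourier_modulated_gaussian:
  fixes y :: "'a::euclidean_space"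
  assumes "a > 0"
  obtains \<phi> :: "'a \<Rightarrow> complex" and C :: real where "integrable lborel \<phi>" "integrable lborel (\<lambda>\<xi>. (cmod (\<phi> \<xi>))\<^sup>2)"
    "C \<noteq> 0" "\<And>x. fourier \<phi> x = complex_of_real (C * exp (- a * (norm (x - y))\<^sup>2))"
proof
  \<comment> \<open>The dilation for which \<open>|x / b|\<^sup>2 / 2 = a |x|\<^sup>2\<close>.\<close>
  define b where "b = 1 / sqrt (2 * a)"
  have b: "b > 0" "b\<^sup>2 = 1 / (2 * a)"
    using assms by (simp_all add: b_def power_divide)
  define \<phi> where "\<phi> \<xi> = exp (\<i> * complex_of_real (\<xi> \<bullet> y)) * complex_of_real (exp (- (norm (b *\<^sub>R \<xi>))\<^sup>2 / 2))"
    for \<xi> :: 'a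
  define C where "C = sqrt (2 * pi) ^ DIM('a) / b ^ DIM('a)"
  have [measurable]: "\<phi> \<in> borel_measurable borel"
    unfolding \<phi>_def by measurable
  have norm_\<phi>: "cmod (\<phi> \<xi>) = exp (- (b\<^sup>2 / 2) * (norm (\<xi> - 0))\<^sup>2)" for \<xi>
    using b(1) by (simp add: \<phi>_def norm_mult power_mult_distrib)
  show "integrable lborel \<phi>"
    using integrable_gaussian[of "b\<^sup>2 / 2" "0::'a"] b(1)
    by (intro Bochner_Integration.integrable_bound[OF integrable_gaussian[of "b\<^sup>2 / 2" "0::'a"]])
       (auto simp: norm_\<phi>)
  have "(cmod (\<phi> \<xi>))\<^sup>2 = exp (- (b\<^sup>2) * (norm (\<xi> - 0))\<^sup>2)" for \<xi>
    unfolding norm_\<phi> by (simp flip: exp_double)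
  then show "integrable lborel (\<lambda>\<xi>. (cmod (\<phi> \<xi>))\<^sup>2)"
    using integrable_gaussian[of "b\<^sup>2" "0::'a"] b(1) by simp
  show "C \<noteq> 0"
    using b(1) by (simp add: C_def)
  fix x :: 'a
  define g where "g z = exp (- \<i> * complex_of_real (z \<bullet> ((1 / b) *\<^sub>R (x - y)))) * complex_of_real (exp (- (norm z)\<^sup>2 / 2))"
    for z :: 'a
  have [measurable]: "g \<in> borel_measurable borel"
    unfolding g_def by measurable
  have "exp (- \<i> * complex_of_real (\<xi> \<bullet> x)) * \<phi> \<xi> = g (b *\<^sub>R \<xi>)" for \<xi>
    using b(1) by (simp add: \<phi>_def g_def inner_diff_right exp_diff exp_minus field_simps flip: mult_exp_exp)
  then have "fourier \<phi> x = (\<integral>\<xi>. g (b *\<^sub>R \<xi>) \<partial>lborel)"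
    unfolding fourier_def by simp
  also have "\<dots> = (1 / b ^ DIM('a)) *\<^sub>R (\<integral>\<xi>. g \<xi> \<partial>lborel)"
    using b(1) by (simp add: integral_scaleR[of g b])
  also have "(\<integral>\<xi>. g \<xi> \<partial>lborel) = fourier (\<lambda>x. complex_of_real (exp (- (norm x)\<^sup>2 / 2))) ((1 / b) *\<^sub>R (x - y))"
    unfolding fourier_def g_def ..
  also have "\<dots> = complex_of_real (sqrt (2 * pi) ^ DIM('a) * exp (- (norm ((1 / b) *\<^sub>R (x - y)))\<^sup>2 / 2))"
    by (rule gaussian_fourier)
  also have "- (norm ((1 / b) *\<^sub>R (x - y)))\<^sup>2 / 2 = - a * (norm (x - y))\<^sup>2"
    using b assms by (simp add: power_divide)
  finally show "fourier \<phi> x = complex_of_real (C * exp (- a * (norm (x - y))\<^sup>2))"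
    by (simp add: C_def scaleR_conv_of_real)
qed

section \<open>Gaussian averages of a function with vanishing Fourier transform\<close>

lemma fourier_multiplication_formula:
  fixes g \<phi> :: "'a::euclidean_space \<Rightarrow> complex"
  assumes g: "integrable lborel g" and \<phi>: "integrable lborel \<phi>"
  shows "(\<integral>\<xi>. fourier g \<xi> * \<phi> \<xi> \<partial>lborel) = (\<integral>x. g x * fourier \<phi> x \<partial>lborel)"
proof -
  define H where "H x \<xi> = exp (- \<i> * complex_of_real (x \<bullet> \<xi>)) * g x * \<phi> \<xi>" for x \<xi>
  have [measurable]: "g \<in> borel_measurable borel" "\<phi> \<in> borel_measurable borel"
    using g \<phi> by auto
  have norm_H: "cmod (H x \<xi>) = cmod (g x) * cmod (\<phi> \<xi>)" for x \<xi>
    by (simp add: H_def norm_mult)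
  have "integrable (lborel \<Otimes>\<^sub>M lborel) (case_prod H)"
  proof (rule lborel_pair.Fubini_integrable)
    show "case_prod H \<in> borel_measurable (lborel \<Otimes>\<^sub>M lborel)"
      unfolding H_def by measurable
    show "integrable lborel (\<lambda>x. \<integral>\<xi>. norm (case (x, \<xi>) of (x, \<xi>) \<Rightarrow> H x \<xi>) \<partial>lborel)"
      using g by (simp add: norm_H)
    have [measurable]: "H x \<in> borel_measurable borel" for x
      unfolding H_def by measurable
    have "integrable lborel (H x)" for x
      by (rule Bochner_Integration.integrable_bound[of _ "\<lambda>\<xi>. cmod (g x) * cmod (\<phi> \<xi>)"])
         (use \<phi> in \<open>auto simp: norm_H\<close>)
    then show "AE x in lborel. integrable lborel (\<lambda>\<xi>. case (x, \<xi>) of (x, \<xi>) \<Rightarrow> H x \<xi>)"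
      by simp
  qed
  then have "(\<integral>\<xi>. \<integral>x. H x \<xi> \<partial>lborel \<partial>lborel) = (\<integral>x. \<integral>\<xi>. H x \<xi> \<partial>lborel \<partial>lborel)"
    by (rule lborel_pair.Fubini_integral)
  moreover have "(\<integral>x. H x \<xi> \<partial>lborel) = fourier g \<xi> * \<phi> \<xi>" for \<xi>
    unfolding H_def fourier_def by simp
  moreover have "(\<integral>\<xi>. H x \<xi> \<partial>lborel) = g x * fourier \<phi> x" for x
  proof -
    have "H x \<xi> = g x * (exp (- \<i> * complex_of_real (\<xi> \<bullet> x)) * \<phi> \<xi>)" for \<xi>
      by (simp add: H_def inner_commute mult_ac)
    then show ?thesis
      unfolding fourier_def by simp
  qed
  ultimately show ?thesis
    by simp
qed

text \<open>Moving the Fourier transform from the truncation of \<open>f\<close> to the preimage \<open>\<phi>\<close> of the Gaussian,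
  the truncated integrals equal \<open>\<integral> fourier (f 1\<^bsub>B(0,R)\<^esub>) * \<phi>\<close>.  These tend to zero by
  the Cauchy--Schwarz inequality, while dominated convergence gives the integral over the whole space.\<close>
lemma L2_fourier_zero_imp_gaussian_integral_zero:
  fixes f :: "'a::euclidean_space \<Rightarrow> complex"
  assumes f: "f \<in> L2" and a: "a > 0"
    and lim: "((\<lambda>R::real. \<integral>\<^sup>+\<xi>. ennreal ((cmod (fourier (\<lambda>x. indicator (cball 0 R) x *\<^sub>R f x) \<xi>))\<^sup>2) \<partial>lborel)
        \<longlongrightarrow> 0) at_top"
  shows "(\<integral>x. f x * complex_of_real (exp (- a * (norm (x - y))\<^sup>2)) \<partial>lborel) = 0"
proof -
  obtain \<phi> :: "'a \<Rightarrow> complex" and C :: real where \<phi>: "integrable lborel \<phi>"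
    "integrable lborel (\<lambda>\<xi>. (cmod (\<phi> \<xi>))\<^sup>2)" and "C \<noteq> 0"
    and fourier_\<phi>: "\<And>x. fourier \<phi> x = complex_of_real (C * exp (- a * (norm (x - y))\<^sup>2))"
    using fourier_modulated_gaussian[OF a] by blast
  have [measurable]: "\<phi> \<in> borel_measurable borel" "f \<in> borel_measurable borel" "fourier \<phi> \<in> borel_measurable borel"
    using \<phi>(1) L2_D[OF f] by (auto intro!: fourier_measurable)
  have [measurable]: "cball (0::'a) R \<in> sets borel" for R
    by simp
  let ?f = "\<lambda>R x. indicator (cball 0 R) x *\<^sub>R f x"
  have "integrable lborel (\<lambda>x. (exp (- a * (norm (x - y))\<^sup>2))\<^sup>2)"
    using integrable_gaussian[of "2 * a" y] a by (simp add: mult.assoc flip: exp_double)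
  then have "integrable lborel (\<lambda>x. (cmod (fourier \<phi> x))\<^sup>2)"
    by (simp add: fourier_\<phi> norm_mult power_mult_distrib)
  then have int: "integrable lborel (\<lambda>x. f x * fourier \<phi> x)"
    using L2_D[OF f] by (intro integrable_mult_L2) auto
  have 1: "((\<lambda>R. \<integral>x. ?f R x * fourier \<phi> x \<partial>lborel) \<longlongrightarrow> (\<integral>x. f x * fourier \<phi> x \<partial>lborel)) at_top"
  proof (rule integral_dominated_convergence_at_top)
    show "integrable lborel (\<lambda>x. norm (f x * fourier \<phi> x))"
      using int by (rule integrable_norm)
    show "\<forall>\<^sub>F R in at_top. AE x in lborel. norm (?f R x * fourier \<phi> x) \<le> norm (f x * fourier \<phi> x)"
      by (auto simp: indicator_def)
    have "\<forall>\<^sub>F R in at_top. ?f R x * fourier \<phi> x = f x * fourier \<phi> x" for x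
      using eventually_ge_at_top[of "norm x"] by eventually_elim simp
    then show "AE x in lborel. ((\<lambda>R. ?f R x * fourier \<phi> x) \<longlongrightarrow> f x * fourier \<phi> x) at_top"
      by (auto intro: tendsto_eventually)
  qed auto
  have "((\<lambda>R. ennreal ((cmod (\<integral>x. ?f R x * fourier \<phi> x \<partial>lborel))\<^sup>2)) \<longlongrightarrow> ennreal 0) at_top"
  proof (rule tendsto_sandwich[OF _ _ tendsto_const])
    let ?K = "\<integral>\<^sup>+\<xi>. ennreal ((cmod (\<phi> \<xi>))\<^sup>2) \<partial>lborel"
    have "?K < top"
      using \<phi>(2) by (simp add: nn_integral_eq_integral)
    then show "((\<lambda>R. ?K * (\<integral>\<^sup>+\<xi>. ennreal ((cmod (fourier (?f R) \<xi>))\<^sup>2) \<partial>lborel)) \<longlongrightarrow> ennreal 0) at_top"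
      using ennreal_tendsto_cmult[OF _ lim, of ?K] by simp
    have "ennreal ((cmod (\<integral>x. ?f R x * fourier \<phi> x \<partial>lborel))\<^sup>2) \<le>
      ?K * (\<integral>\<^sup>+\<xi>. ennreal ((cmod (fourier (?f R) \<xi>))\<^sup>2) \<partial>lborel)" for R
    proof -
      have [measurable]: "fourier (?f R) \<in> borel_measurable borel"
        by (intro fourier_measurable) measurable
      show ?thesis
        unfolding fourier_multiplication_formula[OF integrable_truncated[OF f] \<phi>(1), symmetric]
        by (subst mult.commute) (rule norm_integral_mult_sq_le; measurable)
    qed
    then show "\<forall>\<^sub>F R in at_top. ennreal ((cmod (\<integral>x. ?f R x * fourier \<phi> x \<partial>lborel))\<^sup>2) \<le>
      ?K * (\<integral>\<^sup>+\<xi>. ennreal ((cmod (fourier (?f R) \<xi>))\<^sup>2) \<partial>lborel)"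
      by simp
  qed auto
  then have "((\<lambda>R. (cmod (\<integral>x. ?f R x * fourier \<phi> x \<partial>lborel))\<^sup>2) \<longlongrightarrow> 0) at_top"
    by (subst (asm) tendsto_ennreal_iff) auto
  moreover have "((\<lambda>R. (cmod (\<integral>x. ?f R x * fourier \<phi> x \<partial>lborel))\<^sup>2) \<longlongrightarrow>
      (cmod (\<integral>x. f x * fourier \<phi> x \<partial>lborel))\<^sup>2) at_top"
    by (intro tendsto_intros 1)
  ultimately have "(cmod (\<integral>x. f x * fourier \<phi> x \<partial>lborel))\<^sup>2 = 0"
    using tendsto_unique trivial_limit_at_top_linorder by blast
  moreover have "f x * fourier \<phi> x = complex_of_real C * (f x * complex_of_real (exp (- a * (norm (x - y))\<^sup>2)))" for x
    by (simp add: fourier_\<phi>)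
  ultimately show ?thesis
    using \<open>C \<noteq> 0\<close> by simp
qed

section \<open>From Gaussian averages to vanishing almost everywhere\<close>

text \<open>With \<open>T x = exp (- |x - y|\<^sup>2)\<close> the hypothesis says that \<open>g\<close> annihilates all powers of \<open>T\<close>.
  By Weierstrass approximation on \<open>[0, 1]\<close> it annihilates \<open>h \<circ> T\<close> for every continuous \<open>h\<close>; balls
  around \<open>y\<close> are superlevel sets of \<open>T\<close>, so their indicators are pointwise limits of such functions.\<close>
lemma ball_integral_zero_if_gaussian_integrals_zero:
  fixes g :: "'a::euclidean_space \<Rightarrow> complex"
  assumes g: "integrable lborel g"
    and zero: "\<And>n::nat. (\<integral>x. exp (- real n * (norm (x - y))\<^sup>2) *\<^sub>R g x \<partial>lborel) = 0"
    and "r > 0"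
  shows "(\<integral>x\<in>ball y r. g x \<partial>lborel) = 0"
proof -
  have [measurable]: "g \<in> borel_measurable borel"
    using g by auto
  define T where "T x = exp (- (norm (x - y))\<^sup>2)" for x
  have [measurable]: "T \<in> borel_measurable borel"
    unfolding T_def by measurable
  have T: "T x \<in> {0..1}" for x
    by (simp add: T_def)
  have power_T: "T x ^ n = exp (- real n * (norm (x - y))\<^sup>2)" for x n
    by (simp add: T_def flip: exp_of_nat_mult)
  have int_T: "integrable lborel (\<lambda>x. T x ^ n *\<^sub>R g x)" for n
    by (rule Bochner_Integration.integrable_bound[OF g])
       (use T in \<open>auto simp: mult_left_le_one_le power_le_one\<close>)
  have cont: "(\<integral>x. h (T x) *\<^sub>R g x \<partial>lborel) = 0" if h: "continuous_on UNIV h" for h :: "real \<Rightarrow> real"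
  proof -
    have [measurable]: "h \<in> borel_measurable borel"
      using h by (rule borel_measurable_continuous_onI)
    have "norm (\<integral>x. h (T x) *\<^sub>R g x \<partial>lborel) \<le> e * (\<integral>x. norm (g x) \<partial>lborel)" if "e > 0" for e
    proof -
      obtain p where p: "real_polynomial_function p" "\<And>t. t \<in> {0..1} \<Longrightarrow> \<bar>h t - p t\<bar> < e"
        using Stone_Weierstrass_real_polynomial_function[OF compact_Icc continuous_on_subset[OF h subset_UNIV] \<open>e > 0\<close>]
        by blast
      obtain c m where p_eq: "p = (\<lambda>t. \<Sum>i\<le>m::nat. c i * t ^ i)"
        using p(1) by (auto simp: real_polynomial_function_iff_sum)
      have pT: "p (T x) *\<^sub>R g x = (\<Sum>i\<le>m. c i *\<^sub>R (T x ^ i *\<^sub>R g x))" for x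
        by (simp add: p_eq scaleR_sum_left)
      have int_p: "integrable lborel (\<lambda>x. p (T x) *\<^sub>R g x)"
        unfolding pT using int_T by (intro Bochner_Integration.integrable_sum integrable_scaleR_right)
      have "(\<integral>x. p (T x) *\<^sub>R g x \<partial>lborel) = (\<Sum>i\<le>m. c i *\<^sub>R (\<integral>x. T x ^ i *\<^sub>R g x \<partial>lborel))"
        unfolding pT using int_T by (subst Bochner_Integration.integral_sum) (auto simp del: scaleR_scaleR)
      then have zero_p: "(\<integral>x. p (T x) *\<^sub>R g x \<partial>lborel) = 0"
        by (simp only: power_T zero scaleR_zero_right sum.neutral_const)
      have [measurable]: "p \<in> borel_measurable borel"
        unfolding p_eq by measurable
      have bound: "norm ((h (T x) - p (T x)) *\<^sub>R g x) \<le> e * norm (g x)" for x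
        using p(2)[OF T[of x]] by (auto intro!: mult_right_mono)
      have int_d: "integrable lborel (\<lambda>x. (h (T x) - p (T x)) *\<^sub>R g x)"
        by (rule Bochner_Integration.integrable_bound[of _ "\<lambda>x. e * norm (g x)"])
           (use g bound \<open>e > 0\<close> in auto)
      have "h (T x) *\<^sub>R g x = (h (T x) - p (T x)) *\<^sub>R g x + p (T x) *\<^sub>R g x" for x
        by (simp add: algebra_simps)
      then have "(\<integral>x. h (T x) *\<^sub>R g x \<partial>lborel) = (\<integral>x. (h (T x) - p (T x)) *\<^sub>R g x \<partial>lborel)"
        using int_d int_p zero_p by simp
      also have "norm \<dots> \<le> (\<integral>x. e * norm (g x) \<partial>lborel)"
        using g bound by (intro Bochner_Integration.integral_norm_bound_integral int_d) auto
      finally show ?thesis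
        by simp
    qed
    note small = this
    let ?N = "\<integral>x. norm (g x) \<partial>lborel"
    have "?N \<ge> 0"
      by simp
    have "norm (\<integral>x. h (T x) *\<^sub>R g x \<partial>lborel) \<le> 0 + e" if "e > 0" for e
    proof -
      have "e / (?N + 1) * ?N \<le> e / (?N + 1) * (?N + 1)"
        using \<open>?N \<ge> 0\<close> \<open>e > 0\<close> by (intro mult_left_mono divide_nonneg_nonneg) auto
      also have "\<dots> = e"
        using \<open>?N \<ge> 0\<close> by (intro nonzero_eq_divide_eq[THEN iffD1] refl) linarith
      finally have "e / (?N + 1) * ?N \<le> e" .
      then show ?thesis
        using small[of "e / (?N + 1)"] \<open>?N \<ge> 0\<close> \<open>e > 0\<close> by simp
    qed
    then have "norm (\<integral>x. h (T x) *\<^sub>R g x \<partial>lborel) \<le> 0"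
      by (rule field_le_epsilon)
    then show ?thesis
      by simp
  qed
  define \<tau> where "\<tau> = exp (- r\<^sup>2)"
  \<comment> \<open>Continuous ramps that increase to the indicator of \<open>{t. t > \<tau>}\<close>.\<close>
  define h where "h k t = min 1 (real k * max 0 (t - \<tau>))" for k :: nat and t :: real
  have [measurable]: "ball y r \<in> sets borel"
    by simp
  have "(\<lambda>k. \<integral>x. h k (T x) *\<^sub>R g x \<partial>lborel) \<longlonglongrightarrow> (\<integral>x. indicator (ball y r) x *\<^sub>R g x \<partial>lborel)"
  proof (rule integral_dominated_convergence)
    show "integrable lborel (\<lambda>x. norm (g x))"
      using g by simp
    show "AE x in lborel. norm (h k (T x) *\<^sub>R g x) \<le> norm (g x)" for k
      by (auto simp: h_def intro!: mult_left_le_one_le)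
    have ball: "x \<in> ball y r \<longleftrightarrow> T x > \<tau>" for x
    proof -
      have "norm (x - y) < r \<longleftrightarrow> (norm (x - y))\<^sup>2 < r\<^sup>2"
        using \<open>r > 0\<close> by (meson less_imp_le norm_ge_zero pos2 power2_less_imp_less power_strict_mono)
      then show ?thesis
        by (simp add: T_def \<tau>_def dist_norm norm_minus_commute)
    qed
    have "(\<lambda>k. h k t) \<longlonglongrightarrow> (if t > \<tau> then 1 else 0)" for t
    proof (cases "t > \<tau>")
      case True
      obtain K :: nat where K: "real K > 1 / (t - \<tau>)"
        using reals_Archimedean2 by blast
      have "\<forall>\<^sub>F k in sequentially. h k t = 1"
        using eventually_ge_at_top[of K]
      proof eventually_elim
        case (elim k)
        have "1 = 1 / (t - \<tau>) * (t - \<tau>)"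
          using True by simp
        also have "\<dots> \<le> real k * (t - \<tau>)"
          using K elim True by (intro mult_right_mono) auto
        finally show ?case
          using True by (simp add: h_def)
      qed
      then show ?thesis
        using True by (auto intro: tendsto_eventually)
    qed (auto simp: h_def)
    note h_lim = this
    have "indicator (ball y r) x = (if T x > \<tau> then 1 else 0 :: real)" for x
      using ball[of x] by (simp add: indicator_def del: mem_ball)
    then have "(\<lambda>k. h k (T x) *\<^sub>R g x) \<longlonglongrightarrow> indicator (ball y r) x *\<^sub>R g x" for x
      using tendsto_scaleR[OF h_lim[of "T x"] tendsto_const[of "g x"]] by simp
    then show "AE x in lborel. (\<lambda>k. h k (T x) *\<^sub>R g x) \<longlonglongrightarrow> indicator (ball y r) x *\<^sub>R g x"
      by simp
  qed (auto simp: h_def)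
  moreover have "(\<integral>x. h k (T x) *\<^sub>R g x \<partial>lborel) = 0" for k
    unfolding h_def by (rule cont) (intro continuous_intros)
  ultimately show ?thesis
    unfolding set_lebesgue_integral_def by (simp add: LIMSEQ_const_iff)
qed

text \<open>Balls are not stable under intersection, but open sets are, and the Vitali covering theorem writes
  an open set, up to a null set, as a countable disjoint union of balls.\<close>
lemma AE_zero_if_ball_integrals_zero:
  fixes g :: "'a::euclidean_space \<Rightarrow> complex"
  assumes g: "integrable lborel g"
    and zero: "\<And>y r. r > 0 \<Longrightarrow> (\<integral>x\<in>ball y r. g x \<partial>lborel) = 0"
  shows "AE x in lborel. g x = 0"
proof (rule sigma_finite_measure.density_zero[OF sigma_finite_lborel g])
  have [measurable]: "g \<in> borel_measurable borel"
    using g by auto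
  have int: "set_integrable lborel A g" if "A \<in> sets borel" for A
    using that g unfolding set_integrable_def by (intro integrable_mult_indicator) auto
  have union: "(\<integral>x\<in>(\<Union>n. A n). g x \<partial>lborel) = 0"
    if "disjoint_family A" "\<And>n::nat. A n \<in> sets borel" "\<And>n. (\<integral>x\<in>A n. g x \<partial>lborel) = 0" for A
    using that by (subst lebesgue_integral_countable_add) (auto simp: disjoint_family_on_def intro!: int)
  have "open": "(\<integral>x\<in>U. g x \<partial>lborel) = 0" if U: "open U" for U
  proof -
    let ?K = "{(y, r). r > 0 \<and> ball y r \<subseteq> U}" and ?B = "\<lambda>i :: 'a \<times> real. ball (fst i) (snd i)"
    obtain C where C: "countable C" "C \<subseteq> ?K" "pairwise (\<lambda>i j. disjnt (?B i) (?B j)) C"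
      "negligible (U - (\<Union>i\<in>C. ?B i))"
    proof (rule Vitali_covering_theorem_balls[of U ?K fst snd])
      fix x and d :: real
      assume "x \<in> U" "d > 0"
      then obtain e where e: "e > 0" "ball x e \<subseteq> U"
        using U by (auto simp: open_contains_ball)
      have "ball x (min e (d / 2)) \<subseteq> U"
        using e by (auto simp: subset_iff)
      with e \<open>d > 0\<close> show "\<exists>i. i \<in> ?K \<and> x \<in> ball (fst i) (snd i) \<and> snd i < d"
        by (intro exI[of _ "(x, min e (d / 2))"]) auto
    qed
    \<comment> \<open>Enumerate \<open>C\<close>, with the empty set at unused indices, as \<open>C\<close> may be finite.\<close>
    define A where "A n = (\<Union>i\<in>{i\<in>C. to_nat_on C i = n}. ?B i)" for n
    have A: "A n = {} \<or> (\<exists>i\<in>C. A n = ?B i)" for n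
    proof (cases "\<exists>i\<in>C. to_nat_on C i = n")
      case True
      then obtain i where "i \<in> C" "to_nat_on C i = n"
        by blast
      then have "{i\<in>C. to_nat_on C i = n} = {i}"
        using C(1) by (auto dest: inj_onD[OF inj_on_to_nat_on])
      then show ?thesis
        using \<open>i \<in> C\<close> by (auto simp: A_def)
    qed (auto simp: A_def)
    have [measurable]: "A n \<in> sets borel" for n
      using A[of n] by auto
    have "disjoint_family A"
      unfolding disjoint_family_on_def
    proof (intro ballI impI)
      fix m n :: nat assume "m \<noteq> n"
      have "?B i \<inter> ?B j = {}" if "i \<in> C" "to_nat_on C i = m" "j \<in> C" "to_nat_on C j = n" for i j
      proof -
        have "i \<noteq> j"
          using that \<open>m \<noteq> n\<close> by blast
        then show ?thesis
          using pairwiseD[OF C(3) \<open>i \<in> C\<close> \<open>j \<in> C\<close>] by (simp add: disjnt_def)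
      qed
      then show "A m \<inter> A n = {}"
        unfolding A_def by blast
    qed
    moreover have "(\<integral>x\<in>A n. g x \<partial>lborel) = 0" for n
      using A[of n] C(2) zero by (auto simp: set_lebesgue_integral_def)
    ultimately have "(\<integral>x\<in>(\<Union>n. A n). g x \<partial>lborel) = 0"
      by (intro union) auto
    moreover have "(\<integral>x\<in>U. g x \<partial>lborel) = (\<integral>x\<in>(\<Union>n. A n). g x \<partial>lborel)"
    proof (rule set_integral_cong_set)
      have UA: "(\<Union>n. A n) = (\<Union>i\<in>C. ?B i)"
        unfolding A_def by blast
      have "?B i \<subseteq> U" if "i \<in> C" for i
        using C(2) that by (cases i) auto
      then have sub: "(\<Union>n. A n) \<subseteq> U"
        unfolding UA by blast
      have "U - (\<Union>n. A n) \<in> null_sets lborel"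
        using C(4) U unfolding UA[symmetric] negligible_iff_null_sets
        by (subst (asm) null_sets_completion_iff) auto
      then have "AE x in lborel. x \<notin> U - (\<Union>n. A n)"
        by (rule AE_not_in)
      then show "AE x in lborel. x \<in> (\<Union>n. A n) \<longleftrightarrow> x \<in> U"
        by eventually_elim (use sub in auto)
    qed (use U in \<open>auto simp: set_borel_measurable_def\<close>)
    ultimately show ?thesis
      by simp
  qed
  fix A :: "'a set" assume "A \<in> sets lborel"
  then have A: "A \<in> sigma_sets UNIV {U. open U}"
    by (simp add: borel_def)
  have sets: "X \<in> sets borel" if "X \<in> sigma_sets UNIV {U. open U}" for X :: "'a set"
    using that by (simp add: borel_def)
  have "Int_stable {U :: 'a set. open U}" "{U :: 'a set. open U} \<subseteq> Pow UNIV"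
    by (auto simp: Int_stable_def)
  from this A show "(\<integral>x\<in>A. g x \<partial>lborel) = 0"
  proof (induction rule: sigma_sets_induct_disjoint)
    case (compl X)
    have "(\<integral>x\<in>UNIV. g x \<partial>lborel) = (\<integral>x\<in>X. g x \<partial>lborel) + (\<integral>x\<in>UNIV - X. g x \<partial>lborel)"
      using sets[OF compl(1)] by (subst set_integral_Un[symmetric]) (auto intro!: int)
    then show ?case
      using compl(2) "open"[of UNIV] by simp
  next
    case (union X)
    then show ?case
      using sets by (intro \<open>\<And>A. disjoint_family A \<Longrightarrow> (\<And>n::nat. A n \<in> sets borel) \<Longrightarrow> (\<And>n. (\<integral>x\<in>A n. g x \<partial>lborel) = 0) \<Longrightarrow> (\<integral>x\<in>(\<Union>n. A n). g x \<partial>lborel) = 0\<close>) auto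
  qed (auto intro: "open")
qed

text \<open>A square-integrable \<open>f\<close> need not be integrable, so the argument is run for \<open>f\<close> times the standard
  Gaussian weight.  A product of two Gaussians is a Gaussian around an intermediate centre, which
  reduces the averages of the weighted function to those of \<open>f\<close>.\<close>
lemma L2_eq_zero_if_gaussian_integrals_zero:
  fixes f :: "'a::euclidean_space \<Rightarrow> complex"
  assumes f: "f \<in> L2"
    and zero: "\<And>a y. a > 0 \<Longrightarrow> (\<integral>x. f x * complex_of_real (exp (- a * (norm (x - y))\<^sup>2)) \<partial>lborel) = 0"
  shows "AE x in lborel. f x = 0"
proof -
  define g where "g x = exp (- (norm x)\<^sup>2) *\<^sub>R f x" for x
  have [measurable]: "f \<in> borel_measurable borel"
    using f by (rule L2_D)
  have "integrable lborel (\<lambda>x::'a. (cmod (complex_of_real (exp (- (norm x)\<^sup>2))))\<^sup>2)"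
    using integrable_gaussian[of 2 "0::'a"] by (simp flip: exp_double)
  then have "integrable lborel (\<lambda>x. complex_of_real (exp (- (norm x)\<^sup>2)) * f x)"
    using L2_D[OF f] by (intro integrable_mult_L2) auto
  moreover have "g = (\<lambda>x. complex_of_real (exp (- (norm x)\<^sup>2)) * f x)"
    by (simp add: g_def fun_eq_iff scaleR_conv_of_real)
  ultimately have g: "integrable lborel g"
    by simp
  have "(\<integral>x. exp (- real n * (norm (x - y))\<^sup>2) *\<^sub>R g x \<partial>lborel) = 0" for n :: nat and y
  proof -
    \<comment> \<open>Completing the square: \<open>z\<close> is the centre of the product Gaussian.\<close>
    define z where "z = (real n / (real n + 1)) *\<^sub>R y"
    define k where "k = real n * (norm y)\<^sup>2 - (real n + 1) * (norm z)\<^sup>2"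
    have nz: "(real n + 1) * (x \<bullet> z) = real n * (x \<bullet> y)" for x
      by (simp add: z_def)
    have "- real n * (norm (x - y))\<^sup>2 - (norm x)\<^sup>2 = - (real n + 1) * (norm (x - z))\<^sup>2 - k" for x
      using nz[of x] by (simp add: k_def power2_norm_eq_inner algebra_simps inner_commute)
    then have "exp (- real n * (norm (x - y))\<^sup>2) * exp (- (norm x)\<^sup>2) = exp (- k) * exp (- (real n + 1) * (norm (x - z))\<^sup>2)" for x
      by (simp flip: exp_add add: algebra_simps)
    then have "exp (- real n * (norm (x - y))\<^sup>2) *\<^sub>R g x
      = complex_of_real (exp (- k)) * (f x * complex_of_real (exp (- (real n + 1) * (norm (x - z))\<^sup>2)))" for x
      by (simp only: g_def scaleR_scaleR) (simp add: scaleR_conv_of_real)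
    then show ?thesis
      using zero[of "real n + 1" z] by simp
  qed
  then have "AE x in lborel. g x = 0"
    by (intro AE_zero_if_ball_integrals_zero[OF g] ball_integral_zero_if_gaussian_integrals_zero[OF g])
  then show ?thesis
    by (simp add: g_def)
qed

section \<open>Uniqueness of the fractional Laplacian\<close>

lemma tendsto_zero_if_le_add:
  fixes f g h :: "real \<Rightarrow> ennreal"
  assumes "(f \<longlongrightarrow> 0) F" "(g \<longlongrightarrow> 0) F" "\<And>x. h x \<le> 2 * f x + 2 * g x"
  shows "(h \<longlongrightarrow> 0) F"
proof (rule tendsto_sandwich[OF _ _ tendsto_const])
  have "((\<lambda>x. 2 * f x + 2 * g x) \<longlongrightarrow> 2 * 0 + 2 * 0) F"
    using assms by (intro tendsto_add ennreal_tendsto_cmult) auto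
  then show "((\<lambda>x. 2 * f x + 2 * g x) \<longlongrightarrow> 0) F"
    by simp
qed (use assms(3) in auto)

lemma is_L2_fourier_unique:
  assumes "is_L2_fourier u v" "is_L2_fourier u v'"
  shows "AE \<xi> in lborel. v \<xi> = v' \<xi>"
proof -
  let ?F = "\<lambda>R. fourier (\<lambda>x. indicator (cball 0 R) x *\<^sub>R u x)"
  have "u \<in> L2" "v \<in> L2" "v' \<in> L2"
    using assms by (auto simp: is_L2_fourier_def)
  note [measurable] = fourier_truncated_measurable[OF this(1)] L2_D(1)[OF this(2)] L2_D(1)[OF this(3)]
  have "((\<lambda>R::real. \<integral>\<^sup>+\<xi>. ennreal ((cmod (v \<xi> - v' \<xi>))\<^sup>2) \<partial>lborel) \<longlongrightarrow> 0) at_top"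
  proof (rule tendsto_zero_if_le_add)
    show "((\<lambda>R. \<integral>\<^sup>+\<xi>. ennreal ((cmod (?F R \<xi> - v \<xi>))\<^sup>2) \<partial>lborel) \<longlongrightarrow> 0) at_top"
      "((\<lambda>R. \<integral>\<^sup>+\<xi>. ennreal ((cmod (?F R \<xi> - v' \<xi>))\<^sup>2) \<partial>lborel) \<longlongrightarrow> 0) at_top"
      using assms by (auto simp: is_L2_fourier_def)
    fix R
    have "v \<xi> - v' \<xi> = (?F R \<xi> - v' \<xi>) - (?F R \<xi> - v \<xi>)" for \<xi>
      by simp
    then show "(\<integral>\<^sup>+\<xi>. ennreal ((cmod (v \<xi> - v' \<xi>))\<^sup>2) \<partial>lborel) \<le>
       2 * (\<integral>\<^sup>+\<xi>. ennreal ((cmod (?F R \<xi> - v \<xi>))\<^sup>2) \<partial>lborel) + 2 * (\<integral>\<^sup>+\<xi>. ennreal ((cmod (?F R \<xi> - v' \<xi>))\<^sup>2) \<partial>lborel)"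
      using nn_integral_norm_diff_sq_le[of "\<lambda>\<xi>. ?F R \<xi> - v' \<xi>" lborel "\<lambda>\<xi>. ?F R \<xi> - v \<xi>"]
      by (simp add: add.commute)
  qed
  then have "(\<integral>\<^sup>+\<xi>. ennreal ((cmod (v \<xi> - v' \<xi>))\<^sup>2) \<partial>lborel) = 0"
    by (simp add: tendsto_const_iff)
  then show ?thesis
    by (subst (asm) nn_integral_0_iff_AE) (auto simp: ennreal_eq_0_iff)
qed

text \<open>The truncated Fourier integrals of \<open>u - u'\<close> tend to \<open>v - v' = 0\<close>, so all Gaussian averages of
  \<open>u - u'\<close> vanish.  This replaces the Plancherel theorem.\<close>
lemma is_L2_fourier_inj:
  fixes u u' :: "'a::euclidean_space \<Rightarrow> complex"
  assumes "is_L2_fourier u v" "is_L2_fourier u' v'" and vv': "AE \<xi> in lborel. v \<xi> = v' \<xi>"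
  shows "AE x in lborel. u x = u' x"
proof -
  let ?t = "\<lambda>R f x. indicator (cball (0::'a) R) x *\<^sub>R (f x :: complex)"
  have L2: "u \<in> L2" "v \<in> L2" "u' \<in> L2" "v' \<in> L2"
    using assms by (auto simp: is_L2_fourier_def)
  note [measurable] = fourier_truncated_measurable[OF L2(1)] L2_D(1)[OF L2(2)]
    fourier_truncated_measurable[OF L2(3)] L2_D(1)[OF L2(4)]
  define f where "f x = u x - u' x" for x
  have f: "f \<in> L2"
    unfolding f_def using L2 by (intro L2_diff)
  have fourier_f: "fourier (?t R f) \<xi> = fourier (?t R u) \<xi> - fourier (?t R u') \<xi>" for R \<xi>
  proof -
    have int: "integrable lborel (\<lambda>x. exp (- \<i> * complex_of_real (x \<bullet> \<xi>)) * ?t R h x)" if h: "h \<in> L2" for h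
    proof (rule Bochner_Integration.integrable_bound[OF integrable_truncated[OF h]])
      have [measurable]: "?t R h \<in> borel_measurable borel"
        using borel_measurable_integrable[OF integrable_truncated[OF h]] by simp
      show "(\<lambda>x. exp (- \<i> * complex_of_real (x \<bullet> \<xi>)) * ?t R h x) \<in> borel_measurable lborel"
        by measurable
    qed (auto simp: norm_mult)
    show ?thesis
      unfolding fourier_def using int[OF L2(1)] int[OF L2(3)]
      by (simp add: f_def scaleR_diff_right right_diff_distrib flip: Bochner_Integration.integral_diff)
  qed
  have lim: "((\<lambda>R. \<integral>\<^sup>+\<xi>. ennreal ((cmod (fourier (?t R f) \<xi>))\<^sup>2) \<partial>lborel) \<longlongrightarrow> 0) at_top"
  proof (rule tendsto_zero_if_le_add)
    show "((\<lambda>R. \<integral>\<^sup>+\<xi>. ennreal ((cmod (fourier (?t R u) \<xi> - v \<xi>))\<^sup>2) \<partial>lborel) \<longlongrightarrow> 0) at_top"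
      "((\<lambda>R. \<integral>\<^sup>+\<xi>. ennreal ((cmod (fourier (?t R u') \<xi> - v' \<xi>))\<^sup>2) \<partial>lborel) \<longlongrightarrow> 0) at_top"
      using assms by (auto simp: is_L2_fourier_def)
    fix R
    have "(\<integral>\<^sup>+\<xi>. ennreal ((cmod (fourier (?t R f) \<xi>))\<^sup>2) \<partial>lborel) =
        (\<integral>\<^sup>+\<xi>. ennreal ((cmod ((fourier (?t R u) \<xi> - v \<xi>) - (fourier (?t R u') \<xi> - v' \<xi>)))\<^sup>2) \<partial>lborel)"
      by (rule nn_integral_cong_AE) (use vv' in \<open>eventually_elim, simp add: fourier_f\<close>)
    also have "\<dots> \<le> 2 * (\<integral>\<^sup>+\<xi>. ennreal ((cmod (fourier (?t R u) \<xi> - v \<xi>))\<^sup>2) \<partial>lborel)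
        + 2 * (\<integral>\<^sup>+\<xi>. ennreal ((cmod (fourier (?t R u') \<xi> - v' \<xi>))\<^sup>2) \<partial>lborel)"
      by (rule nn_integral_norm_diff_sq_le) measurable
    finally show "(\<integral>\<^sup>+\<xi>. ennreal ((cmod (fourier (?t R f) \<xi>))\<^sup>2) \<partial>lborel) \<le> \<dots>" .
  qed
  have "AE x in lborel. f x = 0"
    using L2_fourier_zero_imp_gaussian_integral_zero[OF f _ lim]
    by (rule L2_eq_zero_if_gaussian_integrals_zero[OF f])
  then show ?thesis
    by (simp add: f_def)
qed

lemma is_frac_laplacian_unique:
  assumes "is_frac_laplacian \<sigma> u w" "is_frac_laplacian \<sigma> u w'"
  shows "AE x in lborel. w x = w' x"
proof -
  obtain v z where v: "is_L2_fourier u v" "is_L2_fourier w z"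
    "AE \<xi> in lborel. z \<xi> = complex_of_real (norm \<xi> powr (2 * \<sigma>)) * v \<xi>"
    using assms(1) by (auto simp: is_frac_laplacian_def)
  obtain v' z' where v': "is_L2_fourier u v'" "is_L2_fourier w' z'"
    "AE \<xi> in lborel. z' \<xi> = complex_of_real (norm \<xi> powr (2 * \<sigma>)) * v' \<xi>"
    using assms(2) by (auto simp: is_frac_laplacian_def)
  have "AE \<xi> in lborel. z \<xi> = z' \<xi>"
    using is_L2_fourier_unique[OF v(1) v'(1)] v(3) v'(3) by eventually_elim simp
  then show ?thesis
    by (rule is_L2_fourier_inj[OF v(2) v'(2)])
qed

lemma is_frac_laplacian_L2:
  assumes "is_frac_laplacian \<sigma> u w"
  shows "u \<in> L2" "w \<in> L2"
  using assms by (auto simp: is_frac_laplacian_def is_L2_fourier_def)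

lemma is_frac_laplacian_frac_laplacian:
  assumes "is_frac_laplacian \<sigma> u w"
  shows "is_frac_laplacian \<sigma> u (frac_laplacian \<sigma> u)"
  unfolding frac_laplacian_def using assms by (rule someI[of "is_frac_laplacian \<sigma> u"])

text \<open>By uniqueness the integral may be computed with whichever representative is at hand, in
  particular with a dilated one.\<close>
lemma integral_norm_frac_laplacian:
  assumes "is_frac_laplacian \<sigma> u w"
  shows "(\<integral>x. (cmod (frac_laplacian \<sigma> u x))\<^sup>2 \<partial>lborel) = (\<integral>x. (cmod (w x))\<^sup>2 \<partial>lborel)"
proof -
  note fl = is_frac_laplacian_frac_laplacian[OF assms]
  note [measurable] = L2_D(1)[OF is_frac_laplacian_L2(2)[OF fl]] L2_D(1)[OF is_frac_laplacian_L2(2)[OF assms]]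
  show ?thesis
    by (rule integral_cong_AE) (use is_frac_laplacian_unique[OF fl assms] in auto)
qed

section \<open>Lowering the quotient by a dilation\<close>

lemma condition_V_D:
  assumes "condition_V V"
  shows "V \<in> borel_measurable borel"
    and "\<exists>V0 Vinf. 0 < V0 \<and> (\<forall>x. V0 \<le> V x \<and> V x < Vinf)"
proof -
  from assms obtain g where "\<And>x. GDERIV V x :> g x"
    unfolding condition_V_def by blast
  then have "continuous_on UNIV V"
    by (auto simp: gderiv_def intro!: continuous_at_imp_continuous_on has_derivative_continuous)
  then show "V \<in> borel_measurable borel"
    by (rule borel_measurable_continuous_onI)
qed (use assms in \<open>auto simp: condition_V_def\<close>)

lemma integral_potential_bounds:
  fixes V :: "'a::euclidean_space \<Rightarrow> real"
  assumes "V \<in> borel_measurable borel" "0 < V0" "\<And>x. V0 \<le> V x" "\<And>x. V x < Vinf" "u \<in> L2"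
  shows "V0 * (\<integral>x. (cmod (u x))\<^sup>2 \<partial>lborel) \<le> (\<integral>x. V x * (cmod (u x))\<^sup>2 \<partial>lborel)"
    and "(\<integral>x. V x * (cmod (u x))\<^sup>2 \<partial>lborel) \<le> Vinf * (\<integral>x. (cmod (u x))\<^sup>2 \<partial>lborel)"
proof -
  note [measurable] = assms(1) L2_D(1)[OF assms(5)]
  note u = L2_D(2)[OF assms(5)]
  have V: "0 \<le> V x" "V x \<le> Vinf" for x
    using assms(2) assms(3)[of x] assms(4)[of x] by auto
  have int: "integrable lborel (\<lambda>x. V x * (cmod (u x))\<^sup>2)"
    by (rule Bochner_Integration.integrable_bound[of _ "\<lambda>x. Vinf * (cmod (u x))\<^sup>2"])
       (use u V in \<open>auto simp: abs_mult intro!: mult_right_mono order_trans[OF V(2) abs_ge_self]\<close>)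
  have "(\<integral>x. V0 * (cmod (u x))\<^sup>2 \<partial>lborel) \<le> (\<integral>x. V x * (cmod (u x))\<^sup>2 \<partial>lborel)"
    using u int assms(3) by (intro integral_mono mult_right_mono) auto
  then show "V0 * (\<integral>x. (cmod (u x))\<^sup>2 \<partial>lborel) \<le> (\<integral>x. V x * (cmod (u x))\<^sup>2 \<partial>lborel)"
    by simp
  have "(\<integral>x. V x * (cmod (u x))\<^sup>2 \<partial>lborel) \<le> (\<integral>x. Vinf * (cmod (u x))\<^sup>2 \<partial>lborel)"
    using u int V(2) by (intro integral_mono mult_right_mono) auto
  then show "(\<integral>x. V x * (cmod (u x))\<^sup>2 \<partial>lborel) \<le> Vinf * (\<integral>x. (cmod (u x))\<^sup>2 \<partial>lborel)"
    by simp
qed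

lemma I_functional_nonneg:
  assumes "condition_V V"
  shows "0 \<le> I_functional s \<gamma> V u"
proof -
  have "0 \<le> V x" for x
    using condition_V_D(2)[OF assms] by (meson less_imp_le order_trans)
  then show ?thesis
    unfolding I_functional_def norm_sV_sq_def by (auto intro!: divide_nonneg_nonneg add_nonneg_nonneg)
qed

lemma S_inf_le:
  assumes "condition_V V" "v \<in> I_domain s \<gamma>"
  shows "S_inf s \<gamma> V \<le> I_functional s \<gamma> V v"
  unfolding S_inf_def
  by (rule cINF_lower[OF _ assms(2)]) (auto intro!: bdd_belowI2 I_functional_nonneg[OF assms(1)])

text \<open>The dilation leaves the denominator alone and multiplies the kinetic term by
  \<open>c powr (2 * s - \<gamma> / 2) \<le> 1\<close> and the mass by \<open>c powr (- \<gamma> / 2)\<close>.  A large \<open>c\<close> makes the potential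
  term of the dilated function, at most \<open>Vinf\<close> times its mass, smaller than \<open>V0\<close> times the mass
  of \<open>u\<close>.\<close>
lemma I_functional_not_minimal:
  fixes V :: "'a::euclidean_space \<Rightarrow> real"
  assumes V: "condition_V V" and "0 < \<gamma>" "s \<le> \<gamma> / 4" and u: "u \<in> I_domain s \<gamma>"
  shows "\<exists>v\<in>I_domain s \<gamma>. I_functional s \<gamma> V v < I_functional s \<gamma> V u"
proof -
  obtain V0 Vinf where V0: "0 < V0" "\<And>x. V0 \<le> V x" "\<And>x. V x < Vinf"
    using condition_V_D(2)[OF V] by blast
  note V_bounds = integral_potential_bounds[OF condition_V_D(1)[OF V] V0]
  have "V0 < Vinf"
    using V0(2,3)[of 0] by linarith
  define w where "w = frac_laplacian (s / 2) u"
  have uH: "u \<in> Hs s" "\<not> (AE x in lborel. u x = 0)" and D: "D_energy \<gamma> u < \<infinity>"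
    using u by (auto simp: I_domain_def Hs_nonzero_def)
  have w: "is_frac_laplacian (s / 2) u w"
    using uH(1) is_frac_laplacian_frac_laplacian by (auto simp: Hs_def w_def)
  note L2 = is_frac_laplacian_L2[OF w]
  define A M where "A = (\<integral>x. (cmod (w x))\<^sup>2 \<partial>lborel)" and "M = (\<integral>x. (cmod (u x))\<^sup>2 \<partial>lborel)"
  have "0 \<le> A"
    by (simp add: A_def)
  have "0 < M"
    using L2_integral_pos_iff[OF L2(1)] uH(2) by (simp add: M_def)

  \<comment> \<open>The scale makes the bound on the potential term half of \<open>V0\<close> times the mass of \<open>u\<close>; the amplitude
    is the one required by \<open>D_energy_dilate\<close>.\<close>
  define c where "c = (2 * Vinf / V0) powr (2 / \<gamma>)"
  define a where "a = c powr ((2 * real DIM('a) - \<gamma>) / 4)"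
  have "1 \<le> c"
    unfolding c_def using \<open>0 < V0\<close> \<open>V0 < Vinf\<close> \<open>0 < \<gamma>\<close> by (intro ge_one_powr_ge_zero) auto
  then have "0 < c" and "0 < a"
    by (simp_all add: a_def)
  have c_powr: "c powr (- \<gamma> / 2) = V0 / (2 * Vinf)"
    using \<open>0 < V0\<close> \<open>V0 < Vinf\<close> \<open>0 < \<gamma>\<close> by (simp add: c_def powr_powr powr_minus_divide)
  have cN: "c ^ DIM('a) = c powr real DIM('a)"
    using \<open>0 < c\<close> by (simp add: powr_realpow)
  have a2: "a\<^sup>2 = c ^ DIM('a) * c powr (- \<gamma> / 2)"
    unfolding a_def cN using \<open>0 < c\<close> by (simp add: power2_eq_square flip: powr_add) (simp add: field_simps)
  have a4: "a ^ 4 * c powr \<gamma> = (c ^ DIM('a))\<^sup>2"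
  proof -
    have "a ^ 4 = (a\<^sup>2)\<^sup>2"
      by simp
    also have "\<dots> = (c ^ DIM('a))\<^sup>2 * (c powr (- \<gamma> / 2))\<^sup>2"
      unfolding a2 by (rule power_mult_distrib)
    also have "(c powr (- \<gamma> / 2))\<^sup>2 = c powr (- \<gamma>)"
      by (simp add: power2_eq_square flip: powr_add)
    finally show ?thesis
      using \<open>0 < c\<close> by (simp add: powr_minus)
  qed

  define v where "v = dilate a c u"
  have wv: "is_frac_laplacian (s / 2) v (dilate (a * c powr s) c w)"
    unfolding v_def using is_frac_laplacian_dilate[OF w \<open>0 < c\<close>] by simp
  have vL2: "v \<in> L2"
    using wv by (rule is_frac_laplacian_L2)
  have "c ^ DIM('a) * (\<integral>x. (cmod (v x))\<^sup>2 \<partial>lborel) = c ^ DIM('a) * (c powr (- \<gamma> / 2) * M)"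
    unfolding v_def M_def integral_norm_dilate[OF L2(1) \<open>0 < c\<close>] a2 by simp
  then have Mv: "(\<integral>x. (cmod (v x))\<^sup>2 \<partial>lborel) = c powr (- \<gamma> / 2) * M"
    using \<open>0 < c\<close> by simp
  have "c ^ DIM('a) * (\<integral>x. (cmod (frac_laplacian (s / 2) v x))\<^sup>2 \<partial>lborel) =
      c ^ DIM('a) * (c powr (- \<gamma> / 2) * (c powr s)\<^sup>2 * A)"
    unfolding integral_norm_frac_laplacian[OF wv] A_def integral_norm_dilate[OF L2(2) \<open>0 < c\<close>] power_mult_distrib a2
    by simp
  then have "(\<integral>x. (cmod (frac_laplacian (s / 2) v x))\<^sup>2 \<partial>lborel) = c powr (- \<gamma> / 2) * (c powr s)\<^sup>2 * A"
    using \<open>0 < c\<close> by simp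
  also have "c powr (- \<gamma> / 2) * (c powr s)\<^sup>2 = c powr (2 * s - \<gamma> / 2)"
    by (simp add: power2_eq_square flip: powr_add)
  also have "\<dots> * A \<le> c powr 0 * A"
    using \<open>1 \<le> c\<close> \<open>0 \<le> A\<close> \<open>s \<le> \<gamma> / 4\<close> by (intro mult_right_mono powr_mono) auto
  finally have Av: "(\<integral>x. (cmod (frac_laplacian (s / 2) v x))\<^sup>2 \<partial>lborel) \<le> A"
    using \<open>0 < c\<close> by simp
  have "norm_sV_sq s V v \<le> A + Vinf * (c powr (- \<gamma> / 2) * M)"
    unfolding norm_sV_sq_def Mv[symmetric] using V_bounds(2)[OF vL2] Av by (rule add_mono[rotated])
  also have "\<dots> = A + V0 * M / 2"
    unfolding c_powr using \<open>0 < V0\<close> \<open>V0 < Vinf\<close> by simp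
  also have "\<dots> < A + V0 * M"
    using \<open>0 < V0\<close> \<open>0 < M\<close> by simp
  also have "\<dots> \<le> norm_sV_sq s V u"
    unfolding norm_sV_sq_def A_def M_def w_def using V_bounds(1)[OF L2(1)] by simp
  finally have less: "norm_sV_sq s V v < norm_sV_sq s V u" .

  have Dv: "D_energy \<gamma> v = D_energy \<gamma> u"
    unfolding v_def by (rule D_energy_dilate[OF L2_D(1)[OF L2(1)] \<open>0 < c\<close> a4])
  have "\<not> (AE x in lborel. v x = 0)"
    using L2_integral_pos_iff[OF vL2] \<open>0 < M\<close> \<open>0 < c\<close> by (simp add: Mv)
  then have "v \<in> I_domain s \<gamma>"
    using wv D by (auto simp: I_domain_def Hs_nonzero_def Hs_def Dv)
  moreover have "D_energy \<gamma> u \<noteq> 0"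
    using D_energy_eq_0D[OF L2_D(1)[OF L2(1)]] uH(2) by blast
  then have "0 < enn2real (D_energy \<gamma> u)"
    using D by (simp add: enn2real_positive_iff zero_less_iff_neq_zero)
  then have "0 < enn2real (D_energy \<gamma> u) powr (1 / 2)"
    by simp
  then have "I_functional s \<gamma> V v < I_functional s \<gamma> V u"
    unfolding I_functional_def Dv using less by (rule divide_strict_right_mono[rotated])
  ultimately show ?thesis
    by blast
qed

theorem theorem1p2:
  fixes V :: "real ^ 'n \<Rightarrow> real" and s s0 \<gamma> :: real
  assumes "CARD('n) \<ge> 4"
    and "0 < \<gamma>" and "\<gamma> < 4"
    and "s0 = \<gamma> / 4"
    and "0 < s" and "s \<le> s0"
    and "condition_V V"
  shows "\<not> (\<exists>u \<in> I_domain s \<gamma>. I_functional s \<gamma> V u = S_inf s \<gamma> V)"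
proof
  assume "\<exists>u \<in> I_domain s \<gamma>. I_functional s \<gamma> V u = S_inf s \<gamma> V"
  then obtain u where u: "u \<in> I_domain s \<gamma>" "I_functional s \<gamma> V u = S_inf s \<gamma> V" ..
  obtain v where "v \<in> I_domain s \<gamma>" "I_functional s \<gamma> V v < I_functional s \<gamma> V u"
    using I_functional_not_minimal[OF assms(7,2) _ u(1)] assms(4,6) by auto
  with S_inf_le[OF assms(7)] u(2) show False
    by fastforce
qed

end
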